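(* Let $E \subset \mathbb{T}$ be a countable set. Then quasi all $f \in C(\mathbb{T})$ have the property that for every function $h : E \to \mathbb{C}$ there is a subsequence of $(s_n f)_{n}$ converging pointwise to $h$ on $E$.
   Context: $\mathbb{T} = \mathbb{R}/2\pi\mathbb{Z}$ is the unit circle. $C(\mathbb{T})$ is the space of continuous functions $f : \mathbb{T} \to \mathbb{C}$ with the norm $\|f\| = \max_{t \in \mathbb{T}} |f(t)|$. For $f \in C(\mathbb{T})$ and $n \in \mathbb{N}$, $s_n f$ denotes the $n$-th partial sum of the Fourier series of $f$, i.e. $(s_n f)(t) = \sum_{k=-n}^{n} \hat f(k) e^{ikt}$ with $\hat f(k) = \frac{1}{2\pi}\int_{\mathbb{T}} f(s) e^{-iks}\,ds$. In a complete metric space $X$, a property is said to hold for quasi all $x \in X$ if it holds on a residual subset of $X$, that is, on a set containing a dense $G_\delta$ subset of $X$. *)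

theory Defs
  imports "HOL-Analysis.Analysis"
begin

definition cong_2pi :: "real \<Rightarrow> real \<Rightarrow> bool" where
  "cong_2pi x y \<longleftrightarrow> (\<exists>k::int. x - y = 2 * pi * of_int k)"

lemma equivp_cong_2pi: "equivp cong_2pi"
proof (rule equivpI)
  show "reflp cong_2pi"
    by (auto intro!: reflpI exI[of _ 0] simp: cong_2pi_def)
  show "symp cong_2pi"
  proof (rule sympI)
    fix x y assume "cong_2pi x y"
    then obtain k :: int where "x - y = 2 * pi * of_int k"
      by (auto simp: cong_2pi_def)
    then have "y - x = 2 * pi * of_int (- k)"
      by simp
    then show "cong_2pi y x"
      unfolding cong_2pi_def by blast
  qed
  show "transp cong_2pi"
  proof (rule transpI)
    fix x y z assume "cong_2pi x y" "cong_2pi y z"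
    then obtain k l :: int where "x - y = 2 * pi * of_int k" "y - z = 2 * pi * of_int l"
      by (auto simp: cong_2pi_def)
    then have "x - z = 2 * pi * of_int (k + l)"
      by (simp add: algebra_simps)
    then show "cong_2pi x z"
      unfolding cong_2pi_def by blast
  qed
qed

quotient_type circle = real / cong_2pi
  morphisms rep_circle to_circle
  by (rule equivp_cong_2pi)

text \<open>The quotient topology:\<close>

instantiation circle :: topological_space
begin

definition open_circle :: "circle set \<Rightarrow> bool" where
  "open_circle U \<longleftrightarrow> open (to_circle -` U)"

instance
  by standard (auto simp: open_circle_def vimage_Union vimage_Int)

end

lemma continuous_on_to_circle: "continuous_on UNIV to_circle"
  by (auto simp: continuous_on_open_vimage open_circle_def)

lemma surj_to_circle: "to_circle ` {0..2 * pi} = UNIV"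
proof -
  have "x \<in> to_circle ` {0..2 * pi}" for x
  proof (induction x)
    case (1 x)
    define k where "k = \<lfloor>x / (2 * pi)\<rfloor>"
    define y where "y = x - 2 * pi * of_int k"
    have "of_int k \<le> x / (2 * pi)" "x / (2 * pi) < of_int k + 1"
      unfolding k_def by linarith+
    then have "y \<in> {0..2 * pi}"
      by (auto simp: y_def field_simps)
    moreover have "cong_2pi x y"
      by (auto simp: cong_2pi_def y_def)
    then have "to_circle x = to_circle y"
      by (simp add: circle.abs_eq_iff)
    ultimately show ?case
      by blast
  qed
  then show ?thesis
    by blast
qed

lemma compact_UNIV_circle: "compact (UNIV :: circle set)"
proof -
  have "compact (to_circle ` {0..2 * pi})"
    by (intro compact_continuous_image continuous_on_subset[OF continuous_on_to_circle]) auto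
  then show ?thesis
    by (simp only: surj_to_circle)
qed

text \<open>
  Since the circle is compact, boundedness is no restriction: the library type
  \<open>circle \<Rightarrow>\<^sub>C complex\<close> of bounded continuous functions consists of all
  continuous functions, and its supremum norm is the maximum norm.
\<close>

lemma bcontfun_circle:
  "(bcontfun :: (circle \<Rightarrow> complex) set) = {f. continuous_on UNIV f}"
  using compact_continuous_image[OF _ compact_UNIV_circle]
  by (auto simp: bcontfun_def intro: compact_imp_bounded)

lemma norm_bcontfun_circle_attained:
  fixes f :: "circle \<Rightarrow>\<^sub>C complex"
  obtains t where "norm f = norm (f t)" "\<And>u. norm (f u) \<le> norm (f t)"
proof -
  have "continuous_on UNIV (\<lambda>t. norm (f t))"
    by (intro continuous_on_norm) simp
  from continuous_attains_sup[OF compact_UNIV_circle _ this]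
  obtain t where t: "\<And>u. norm (f u) \<le> norm (f t)"
    by auto
  then have "norm f = norm (f t)"
    by (intro antisym norm_bound norm_bounded)
  with t show ?thesis
    by (rule that[rotated])
qed

text \<open>
  The library's instance of class \<open>complete_space\<close> for bounded continuous functions
  asks for a metric on the domain, so completeness is established directly.
\<close>

lemma complete_bcontfun_circle: "complete (UNIV :: (circle \<Rightarrow>\<^sub>C complex) set)"
proof (rule completeI)
  fix f :: "nat \<Rightarrow> circle \<Rightarrow>\<^sub>C complex"
  assume "Cauchy f"
  have "uniformly_Cauchy_on UNIV (\<lambda>n. apply_bcontfun (f n))"
  proof (rule uniformly_Cauchy_onI)
    fix e :: real assume "e > 0"
    then obtain M where "\<And>m n. m \<ge> M \<Longrightarrow> n \<ge> M \<Longrightarrow> dist (f m) (f n) < e"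
      using \<open>Cauchy f\<close> unfolding Cauchy_def by blast
    then have "\<forall>x\<in>UNIV. \<forall>m\<ge>M. \<forall>n\<ge>M. dist (f m x) (f n x) < e"
      by (intro ballI allI impI dist_fun_lt_imp_dist_val_lt)
    then show "\<exists>M. \<forall>x\<in>UNIV. \<forall>m\<ge>M. \<forall>n\<ge>M. dist (f m x) (f n x) < e" ..
  qed
  then obtain g where "uniform_limit UNIV f g sequentially"
    using Cauchy_uniformly_convergent unfolding uniformly_convergent_on_def by blast
  from uniform_limit_bcontfunE[OF this sequentially_bot]
  obtain l where "f \<longlonglongrightarrow> l" .
  then show "\<exists>l\<in>UNIV. f \<longlonglongrightarrow> l"
    by (rule bexI) simp
qed

lift_definition circle_exp :: "int \<Rightarrow> circle \<Rightarrow> complex"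
  is "\<lambda>k t. exp (\<i> * of_int k * complex_of_real t)"
proof -
  fix k :: int and x y :: real
  assume "cong_2pi x y"
  then obtain l :: int where "x - y = 2 * pi * of_int l"
    by (auto simp: cong_2pi_def)
  then have x: "x = y + 2 * pi * of_int l"
    by simp
  have "\<i> * of_int k * complex_of_real x
      = \<i> * of_int k * complex_of_real y + \<i> * (of_int (k * l) * (of_real pi * 2))"
    by (simp add: x algebra_simps)
  then show "exp (\<i> * of_int k * complex_of_real x) = exp (\<i> * of_int k * complex_of_real y)"
    by (simp only: exp_plus_2pin)
qed

definition fourier_coeff :: "(circle \<Rightarrow> complex) \<Rightarrow> int \<Rightarrow> complex" where
  "fourier_coeff f k =
     1 / (2 * pi) * integral {0..2 * pi} (\<lambda>s. f (to_circle s) * circle_exp (- k) (to_circle s))"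

definition fourier_partial_sum :: "nat \<Rightarrow> (circle \<Rightarrow> complex) \<Rightarrow> circle \<Rightarrow> complex" where
  "fourier_partial_sum n f t = (\<Sum>k = - int n..int n. fourier_coeff f k * circle_exp k t)"

definition residual :: "'a::topological_space set \<Rightarrow> bool" where
  "residual A \<longleftrightarrow> (\<exists>G. gdelta_in euclidean G \<and> closure G = UNIV \<and> G \<subseteq> A)"

definition quasi_all :: "('a::metric_space \<Rightarrow> bool) \<Rightarrow> bool" where
  "quasi_all P \<longleftrightarrow> residual {x. P x}"

end

theory Submission
  imports Defs
begin

text \<open>
  By Baire's theorem it suffices to treat finitely many points at a time: for a finite
  \<open>F \<subseteq> E\<close>, target values \<open>c\<close> on \<open>F\<close>, a tolerance \<open>e\<close> and an index \<open>N\<close>, the functions \<open>f\<close>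
  such that some \<open>s\<^sub>n f\<close> with \<open>n \<ge> N\<close> lies within \<open>e\<close> of \<open>c\<close> on \<open>F\<close> form an open set, because
  each evaluation \<open>f \<mapsto> s\<^sub>n f(t)\<close> is continuous. Taking the values of \<open>c\<close> in a countable dense
  subset of the plane leaves countably many such sets, and a function in all of them has, for
  every \<open>h\<close>, a subsequence of partial sums tending to \<open>h\<close> on \<open>E\<close>, by diagonalising over an
  exhaustion of \<open>E\<close> by finite sets.

  The point is that these sets are dense. Trigonometric polynomials \<open>p\<close> are dense and satisfy
  \<open>s\<^sub>n p = p\<close> for large \<open>n\<close>, so one has to find \<open>g\<close> of small norm with \<open>s\<^sub>n g\<close> close to \<open>c - p\<close>
  on \<open>F\<close>, for one and the same \<open>n\<close> at all points (\<open>fejer_interpolation\<close>). This quantifies the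
  failure of pointwise convergence of Fourier series, and Fejer's polynomials
  \<open>P\<^sub>n(u) = (\<Sum>k=1..n. (u\<^sup>n\<^sup>-\<^sup>k - u\<^sup>n\<^sup>+\<^sup>k) / k)\<close>, \<open>u = e\<^sup>i\<^sup>t\<close>, provide it: they are bounded on the circle
  uniformly in \<open>n\<close> (\<open>norm_fejer_poly_le\<close>), while their partial sums \<open>s\<^sub>n P\<^sub>n\<close>, the halves with
  frequencies below \<open>n\<close>, equal the harmonic number \<open>H\<^sub>n\<close> at \<open>u = 1\<close> and stay bounded in \<open>n\<close> at
  every other point (\<open>norm_fejer_half_le\<close>). Hence, after rotating the peak to a point \<open>x\<close> and
  dividing by \<open>H\<^sub>n\<close>, one obtains functions of norm \<open>O(1 / H\<^sub>n)\<close> whose \<open>n\<close>-th partial sum is \<open>1\<close> at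
  \<open>x\<close> and tends to \<open>0\<close> at all other points; linear combinations of them attain any prescribed
  values on \<open>F\<close> in the limit.
\<close>

section \<open>Characters of the circle\<close>

lemma circle_exp_to_circle: "circle_exp k (to_circle s) = exp (\<i> * of_int k * complex_of_real s)"
  by (simp add: circle_exp.abs_eq)

lemma continuous_on_circle_iff:
  fixes f :: "circle \<Rightarrow> 'a::topological_space"
  shows "continuous_on UNIV f \<longleftrightarrow> continuous_on UNIV (\<lambda>s. f (to_circle s))"
  by (simp add: continuous_on_open_vimage open_circle_def vimage_def)

lemma circle_exp_add: "circle_exp (j + k) t = circle_exp j t * circle_exp k t"
  by (induction t) (simp add: circle_exp_to_circle ring_distribs exp_add)

lemma norm_circle_exp [simp]: "norm (circle_exp k t) = 1"
  by (induction t) (simp add: circle_exp_to_circle)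

lemma circle_exp_0 [simp]: "circle_exp 0 t = 1"
  by (induction t) (simp add: circle_exp_to_circle)

lemma circle_exp_uminus: "circle_exp (- k) t = cnj (circle_exp k t)"
  by (induction t) (simp add: circle_exp_to_circle exp_cnj)

lemma circle_exp_of_nat: "circle_exp (int n) t = circle_exp 1 t ^ n"
  by (induction n) (simp_all add: circle_exp_add mult.commute)

lemma continuous_on_circle_exp [continuous_intros]: "continuous_on UNIV (circle_exp k)"
  unfolding continuous_on_circle_iff circle_exp_to_circle by (intro continuous_intros)

text \<open>
  The first character identifies the quotient of the line with the unit circle of the complex
  plane, which allows distinct points to be told apart and polynomial approximation to be used.
\<close>

lemma inj_circle_exp_1: "inj (circle_exp 1)"
proof (rule injI)
  fix x y assume "circle_exp 1 x = circle_exp 1 y"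
  then show "x = y"
  proof (induction x; induction y)
    fix a b assume "circle_exp 1 (to_circle b) = circle_exp 1 (to_circle a)"
    then obtain n :: int where "\<i> * complex_of_real b = \<i> * complex_of_real a + of_int (2 * n) * pi * \<i>"
      by (auto simp: circle_exp_to_circle exp_eq)
    then have "\<i> * complex_of_real b = \<i> * complex_of_real (a + of_int (2 * n) * pi)"
      by (simp add: algebra_simps)
    then have "b = a + of_int (2 * n) * pi"
      by (metis complex_i_not_zero mult_left_cancel of_real_eq_iff)
    then have "cong_2pi b a"
      unfolding cong_2pi_def by (intro exI[of _ n]) simp
    then show "to_circle b = to_circle a"
      by (simp add: circle.abs_eq_iff)
  qed
qed

section \<open>Fourier coefficients and partial sums\<close>

lemma fourier_integrand_continuous:
  assumes "continuous_on UNIV f"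
  shows "continuous_on {0..2 * pi} (\<lambda>s. f (to_circle s) * circle_exp k (to_circle s))"
proof -
  have "continuous_on UNIV (\<lambda>t. f t * circle_exp k t)"
    by (intro continuous_intros assms)
  then show ?thesis
    unfolding continuous_on_circle_iff by (rule continuous_on_subset) simp
qed

lemmas fourier_integrable = integrable_continuous_real[OF fourier_integrand_continuous]

lemma fourier_coeff_add:
  assumes "continuous_on UNIV f" "continuous_on UNIV g"
  shows "fourier_coeff (\<lambda>t. f t + g t) k = fourier_coeff f k + fourier_coeff g k"
  using assms by (simp add: fourier_coeff_def ring_distribs integral_add fourier_integrable)

lemma fourier_coeff_cmult: "fourier_coeff (\<lambda>t. c * f t) k = c * fourier_coeff f k"
  by (simp add: fourier_coeff_def mult.assoc)

lemma norm_fourier_coeff_le: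
  assumes "continuous_on UNIV f" "\<And>t. norm (f t) \<le> B"
  shows "norm (fourier_coeff f k) \<le> B"
proof -
  have "norm (integral {0..2 * pi} (\<lambda>s. f (to_circle s) * circle_exp (- k) (to_circle s))) \<le> B * (2 * pi - 0)"
    by (rule integral_bound) (use assms in \<open>auto intro: fourier_integrand_continuous simp: norm_mult\<close>)
  then show ?thesis
    by (simp add: fourier_coeff_def norm_mult norm_divide field_simps)
qed

lemma fourier_coeff_circle_exp: "fourier_coeff (circle_exp j) k = (if j = k then 1 else 0)"
proof (cases "j = k")
  case True
  then have "circle_exp j t * circle_exp (- k) t = 1" for t
    using circle_exp_add[of k "-k" t] by simp
  then show ?thesis using True
    by (simp add: fourier_coeff_def scaleR_conv_of_real)
next
  case False
  define m where "m = j - k"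
  then have "m \<noteq> 0" using False by simp
  have eq: "circle_exp j (to_circle s) * circle_exp (- k) (to_circle s) = exp (\<i> * of_int m * complex_of_real s)" for s
    using circle_exp_add[of j "-k" "to_circle s"] by (simp add: circle_exp_to_circle m_def)
  \<comment> \<open>The integrand is a nontrivial character, whose primitive \<open>G\<close> is again \<open>2\<pi>\<close>-periodic.\<close>
  define G where "G s = exp (\<i> * of_int m * complex_of_real s) / (\<i> * of_int m)" for s
  have "((\<lambda>s. exp (\<i> * of_int m * complex_of_real s)) has_integral (G (2 * pi) - G 0)) {0..2*pi}"
  proof (rule fundamental_theorem_of_calculus)
    fix x
    have "((\<lambda>z. exp (\<i> * of_int m * z) / (\<i> * of_int m)) has_field_derivative exp (\<i> * of_int m * complex_of_real x))
       (at (complex_of_real x))"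
      using \<open>m \<noteq> 0\<close> by (auto intro!: derivative_eq_intros)
    then have "((\<lambda>s. exp (\<i> * of_int m * complex_of_real s) / (\<i> * of_int m)) has_vector_derivative
        exp (\<i> * of_int m * complex_of_real x)) (at x within {0..2*pi})"
      by (rule has_vector_derivative_real_field)
    then show "(G has_vector_derivative exp (\<i> * of_int m * complex_of_real x)) (at x within {0..2*pi})"
      by (simp add: G_def[abs_def])
  qed simp
  moreover have "circle_exp m (to_circle (2 * pi)) = circle_exp m (to_circle 0)"
  proof -
    have "cong_2pi (2 * pi) 0" unfolding cong_2pi_def by (rule exI[of _ 1]) simp
    then have "to_circle (2 * pi) = to_circle 0" by (simp add: circle.abs_eq_iff)
    then show ?thesis by simp
  qed
  then have "G (2 * pi) = G 0"
    by (simp add: G_def circle_exp_to_circle)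
  ultimately show ?thesis using False
    by (simp add: fourier_coeff_def eq integral_unique)
qed

lemma fourier_partial_sum_add:
  assumes "continuous_on UNIV f" "continuous_on UNIV g"
  shows "fourier_partial_sum n (\<lambda>t. f t + g t) x = fourier_partial_sum n f x + fourier_partial_sum n g x"
  by (simp add: fourier_partial_sum_def fourier_coeff_add assms ring_distribs sum.distrib)

lemma fourier_partial_sum_cmult:
  "fourier_partial_sum n (\<lambda>t. c * f t) x = c * fourier_partial_sum n f x"
  by (simp add: fourier_partial_sum_def fourier_coeff_cmult sum_distrib_left mult.assoc)

lemma fourier_partial_sum_sum:
  assumes "finite A" "\<And>i. i \<in> A \<Longrightarrow> continuous_on UNIV (f i)"
  shows "fourier_partial_sum n (\<lambda>t. \<Sum>i\<in>A. f i t) x = (\<Sum>i\<in>A. fourier_partial_sum n (f i) x)"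
  using assms
proof (induction A rule: finite_induct)
  case empty
  then show ?case using fourier_partial_sum_cmult[of n 0 "\<lambda>_. 0" x] by simp
next
  case (insert i A)
  then show ?case
    by (simp add: fourier_partial_sum_add continuous_on_sum)
qed

lemma fourier_partial_sum_circle_exp:
  "fourier_partial_sum n (circle_exp j) t = (if \<bar>j\<bar> \<le> int n then circle_exp j t else 0)"
  unfolding fourier_partial_sum_def fourier_coeff_circle_exp
  by (auto simp: if_distrib[of "\<lambda>x. x * _"] sum.delta cong: if_cong)

text \<open>
  A crude bound, growing linearly instead of logarithmically in \<open>n\<close>, is enough to make each
  single \<open>s\<^sub>n\<close> continuous.
\<close>

lemma norm_fourier_partial_sum_le:
  assumes "continuous_on UNIV f" "\<And>t. norm (f t) \<le> B"
  shows "norm (fourier_partial_sum n f t) \<le> (2 * n + 1) * B"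
proof -
  have "norm (fourier_partial_sum n f t) \<le> (\<Sum>k = - int n..int n. B)"
    unfolding fourier_partial_sum_def
    by (rule sum_norm_le) (simp add: norm_mult norm_fourier_coeff_le assms)
  then show ?thesis by (simp add: algebra_simps)
qed

lemma continuous_on_fourier_partial_sum:
  "continuous_on UNIV (\<lambda>f :: circle \<Rightarrow>\<^sub>C complex. fourier_partial_sum n f t)"
proof (rule continuous_on_subset[OF linear_continuous_on subset_UNIV], rule bounded_linear_intro)
  fix f g :: "circle \<Rightarrow>\<^sub>C complex" and r :: real
  show "fourier_partial_sum n (f + g) t = fourier_partial_sum n f t + fourier_partial_sum n g t"
    using fourier_partial_sum_add[of f g n t] by (simp add: plus_bcontfun.rep_eq[abs_def])
  show "fourier_partial_sum n (r *\<^sub>R f) t = r *\<^sub>R fourier_partial_sum n f t"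
    using fourier_partial_sum_cmult[of n "of_real r" f t] by (simp add: scaleR_conv_of_real)
  show "norm (fourier_partial_sum n f t) \<le> norm f * (2 * n + 1)"
    using norm_fourier_partial_sum_le[of f "norm f" n t] by (simp add: norm_bounded algebra_simps)
qed

section \<open>Fejer's polynomials\<close>

text \<open>
  Summation by parts: multiplication by \<open>1 - u\<close> turns the sum into boundary terms and a sum over
  the differences \<open>1 / k - 1 / (k + 1)\<close>, which telescope because the weights \<open>1 / k\<close> decrease.
\<close>

lemma norm_weighted_geometric_tail_le:
  fixes u :: complex
  assumes "norm u = 1" "u \<noteq> 1" "m > 0"
  shows "norm (\<Sum>k=m..n. u ^ k / of_nat k) \<le> 2 / (m * norm (1 - u))"
proof (cases "m \<le> n")
  case False
  then show ?thesis by simp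
next
  case True
  \<comment> \<open>With the upper boundary term included, each step adds only one weight difference.\<close>
  then have *: "norm ((1 - u) * (\<Sum>k=m..n. u ^ k / of_nat k) + u ^ Suc n / of_nat n) \<le> 1 / m + (1 / m - 1 / n)"
  proof (induction n rule: dec_induct)
    case base
    have "(1 - u) * (u ^ m / of_nat m) + u ^ Suc m / of_nat m = u ^ m / of_nat m"
      by (simp add: left_diff_distrib diff_divide_distrib)
    then show ?case by (simp add: norm_divide norm_power assms)
  next
    case (step n)
    have "n > 0" using step assms by simp
    let ?S = "\<Sum>k=m..n. u ^ k / of_nat k"
    have eq: "(1 - u) * (\<Sum>k=m..Suc n. u ^ k / of_nat k) + u ^ Suc (Suc n) / of_nat (Suc n)
      = ((1 - u) * ?S + u ^ Suc n / of_nat n) - u ^ Suc n * of_real (1 / n - 1 / Suc n)"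
      using step \<open>n > 0\<close> by (simp add: field_simps del: of_nat_Suc)
    moreover have "norm (u ^ Suc n * of_real (1 / n - 1 / Suc n)) = 1 / n - 1 / Suc n"
      unfolding norm_mult norm_power norm_of_real using \<open>n > 0\<close> by (simp add: assms field_simps)
    ultimately show ?case
      unfolding eq
      using norm_triangle_ineq4[of "(1 - u) * ?S + u ^ Suc n / of_nat n" "u ^ Suc n * of_real (1 / n - 1 / Suc n)"] step.IH
      by linarith
  qed
  let ?S = "\<Sum>k=m..n. u ^ k / of_nat k"
  have "norm ((1 - u) * ?S) \<le> norm ((1 - u) * ?S + u ^ Suc n / of_nat n) + norm (u ^ Suc n / of_nat n)"
    by (metis add_diff_cancel_right' norm_triangle_ineq4)
  also have "norm (u ^ Suc n / of_nat n) = 1 / n"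
    unfolding norm_divide norm_power by (simp add: assms)
  finally have "norm (1 - u) * norm ?S \<le> 2 / m" using * by (simp add: norm_mult)
  then show ?thesis using assms by (simp add: field_simps)
qed

lemma norm_power_minus_one_le:
  fixes u :: complex
  assumes "norm u = 1"
  shows "norm (u ^ k - 1) \<le> k * norm (u - 1)"
  using norm_power_diff[of u 1 k] assms by simp

text \<open>
  For \<open>u = e\<^sup>i\<^sup>\<theta>\<close> these are the partial sums of \<open>\<Sum> sin (k \<theta>) / k\<close>. The terms are at most
  \<open>d = \<bar>1 - u\<bar>\<close> in absolute value, so the first \<open>1 / d\<close> of them contribute at most \<open>1\<close>, while
  summation by parts bounds the terms beyond \<open>1 / d\<close> by \<open>2\<close>.
\<close>

lemma abs_sine_sum_le:
  fixes u :: complex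
  assumes "norm u = 1"
  shows "\<bar>\<Sum>k=1..n. Im (u ^ k) / k\<bar> \<le> 3"
proof (cases "u = 1")
  case True
  then show ?thesis by simp
next
  case False
  define d where "d = norm (1 - u)"
  have "d > 0" using False by (simp add: d_def)
  define m where "m = nat \<lfloor>1 / d\<rfloor>"
  have m: "m * d \<le> 1" "1 \<le> (m + 1) * d"
  proof -
    have "real m = of_int \<lfloor>1 / d\<rfloor>" using \<open>d > 0\<close> by (simp add: m_def)
    then have "m \<le> 1 / d" "1 / d \<le> m + 1" by linarith+
    then show "m * d \<le> 1" "1 \<le> (m + 1) * d" using \<open>d > 0\<close> by (simp_all add: field_simps)
  qed
  have head: "\<bar>\<Sum>k=1..min m n. Im (u ^ k) / k\<bar> \<le> 1"
  proof -
    have "\<bar>Im (u ^ k) / k\<bar> \<le> d" if "k \<in> {1..min m n}" for k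
    proof -
      have "\<bar>Im (u ^ k)\<bar> \<le> norm (u ^ k - 1)"
        using abs_Im_le_cmod[of "u ^ k - 1"] by simp
      also have "\<dots> \<le> k * d"
        using norm_power_minus_one_le[OF assms, of k] by (simp add: d_def norm_minus_commute)
      finally show ?thesis using that by (simp add: field_simps)
    qed
    then have "\<bar>\<Sum>k=1..min m n. Im (u ^ k) / k\<bar> \<le> (\<Sum>k=1..min m n. d)"
      by (intro order.trans[OF sum_abs] sum_mono)
    also have "\<dots> \<le> m * d" using \<open>d > 0\<close> by simp
    finally show ?thesis using m by simp
  qed
  have tail: "\<bar>\<Sum>k=m+1..n. Im (u ^ k) / k\<bar> \<le> 2"
  proof -
    have "(\<Sum>k=m+1..n. Im (u ^ k) / k) = Im (\<Sum>k=m+1..n. u ^ k / of_nat k)"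
      by (simp add: Im_divide_of_nat)
    also have "\<bar>\<dots>\<bar> \<le> norm (\<Sum>k=m+1..n. u ^ k / of_nat k)"
      by (rule abs_Im_le_cmod)
    also have "\<dots> \<le> 2 / ((m + 1) * d)"
      using norm_weighted_geometric_tail_le[OF assms False, of "m + 1" n] by (simp add: d_def)
    also have "\<dots> \<le> 2" using m \<open>d > 0\<close> by (simp add: field_simps)
    finally show ?thesis .
  qed
  have "{1..n} = {1..min m n} \<union> {m+1..n}" by auto
  then have "(\<Sum>k=1..n. Im (u ^ k) / k) = (\<Sum>k=1..min m n. Im (u ^ k) / k) + (\<Sum>k=m+1..n. Im (u ^ k) / k)"
    by (simp add: sum.union_disjoint)
  then show ?thesis using head tail by linarith
qed

text \<open>
  On the unit circle \<open>fejer_half n\<close> is the part of \<open>fejer_poly n\<close> with frequencies below \<open>n\<close>, that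
  is, its \<open>n\<close>-th Fourier partial sum; the frequency \<open>n\<close> itself is absent from \<open>fejer_poly n\<close>.
\<close>

definition fejer_half :: "nat \<Rightarrow> complex \<Rightarrow> complex" where
  "fejer_half n u = (\<Sum>k=1..n. u ^ (n - k) / of_nat k)"

definition fejer_poly :: "nat \<Rightarrow> complex \<Rightarrow> complex" where
  "fejer_poly n u = (\<Sum>k=1..n. (u ^ (n - k) - u ^ (n + k)) / of_nat k)"

lemma power_diff_unit:
  fixes u :: complex
  assumes "norm u = 1" "k \<le> n"
  shows "u ^ (n - k) = u ^ n * cnj u ^ k"
proof -
  have "u * cnj u = 1" using assms by (simp add: complex_norm_square[symmetric])
  have "u ^ n * cnj u ^ k = u ^ (n - k) * (u * cnj u) ^ k"
    unfolding power_mult_distrib mult.assoc[symmetric] power_add[symmetric] using assms by simp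
  then show ?thesis using \<open>u * cnj u = 1\<close> by simp
qed

text \<open>
  The two halves are mirror images around frequency \<open>n\<close>, so that after factoring out \<open>u\<^sup>n\<close> they
  combine to a sine sum: the logarithmic growth of each half at \<open>u = 1\<close> cancels.
\<close>

lemma norm_fejer_poly_le:
  assumes "norm u = 1"
  shows "norm (fejer_poly n u) \<le> 6"
proof -
  have "fejer_poly n u = (\<Sum>k=1..n. - (2 * \<i> * u ^ n) * of_real (Im (u ^ k) / k))"
    unfolding fejer_poly_def
  proof (rule sum.cong[OF refl])
    fix k assume "k \<in> {1..n}"
    then have "u ^ (n - k) - u ^ (n + k) = - (u ^ n) * (u ^ k - cnj (u ^ k))"
      by (simp add: power_diff_unit assms power_add algebra_simps)
    also have "u ^ k - cnj (u ^ k) = 2 * \<i> * of_real (Im (u ^ k))"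
      by (simp add: complex_eq_iff del: complex_cnj_power)
    finally show "(u ^ (n - k) - u ^ (n + k)) / of_nat k = - (2 * \<i> * u ^ n) * of_real (Im (u ^ k) / k)"
      by simp
  qed
  also have "\<dots> = - (2 * \<i> * u ^ n) * of_real (\<Sum>k=1..n. Im (u ^ k) / k)"
    by (simp only: sum_distrib_left of_real_sum)
  finally have "norm (fejer_poly n u) = 2 * \<bar>\<Sum>k=1..n. Im (u ^ k) / k\<bar>"
    by (simp only: norm_mult norm_minus_cancel norm_of_real norm_power) (simp add: assms)
  then show ?thesis using abs_sine_sum_le[OF assms, of n] by simp
qed

text \<open>
  A half on its own loses this cancellation at \<open>u = 1\<close> only: there its value is unbounded in
  \<open>n\<close>, whereas summation by parts keeps it bounded at any fixed \<open>u \<noteq> 1\<close>.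
\<close>

lemma fejer_half_1: "fejer_half n 1 = of_real (harm n)"
  by (simp add: fejer_half_def harm_def divide_inverse)

lemma norm_fejer_half_le:
  assumes "norm u = 1" "u \<noteq> 1"
  shows "norm (fejer_half n u) \<le> 2 / norm (1 - u)"
proof -
  have "fejer_half n u = u ^ n * (\<Sum>k=1..n. cnj u ^ k / of_nat k)"
    by (simp add: fejer_half_def sum_distrib_left power_diff_unit assms)
  then have "norm (fejer_half n u) = norm (\<Sum>k=1..n. cnj u ^ k / of_nat k)"
    by (simp add: norm_mult norm_power assms)
  also have "\<dots> \<le> 2 / norm (1 - cnj u)"
    using norm_weighted_geometric_tail_le[of "cnj u" 1 n] assms by simp
  also have "norm (1 - cnj u) = norm (1 - u)"
    by (metis complex_cnj_diff complex_cnj_one complex_mod_cnj)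
  finally show ?thesis .
qed

lemma continuous_on_fejer_poly:
  assumes "continuous_on S f"
  shows "continuous_on S (\<lambda>t. fejer_poly n (f t))"
  unfolding fejer_poly_def by (intro continuous_intros assms) auto

text \<open>
  The factor \<open>a\<close> will be the conjugate of a point of the unit circle, which moves the peak to
  that point.
\<close>

lemma fourier_partial_sum_fejer_poly:
  "fourier_partial_sum n (\<lambda>t. fejer_poly n (circle_exp 1 t * a)) x = fejer_half n (circle_exp 1 x * a)"
proof -
  have expansion: "(\<lambda>t. fejer_poly n (circle_exp 1 t * a)) = (\<lambda>t. \<Sum>k=1..n. a ^ (n - k) / of_nat k * circle_exp (int (n - k)) t
       + (- (a ^ (n + k) / of_nat k)) * circle_exp (int (n + k)) t)"
    unfolding fejer_poly_def circle_exp_of_nat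
    by (intro ext sum.cong) (simp_all add: power_mult_distrib field_simps)
  have "fourier_partial_sum n (\<lambda>t. fejer_poly n (circle_exp 1 t * a)) x =
     (\<Sum>k=1..n. a ^ (n - k) / of_nat k * fourier_partial_sum n (circle_exp (int (n - k))) x
       + (- (a ^ (n + k) / of_nat k)) * fourier_partial_sum n (circle_exp (int (n + k))) x)"
    unfolding expansion
    by (simp only: fourier_partial_sum_sum finite_atLeastAtMost continuous_on_add continuous_on_mult_left
         continuous_on_circle_exp fourier_partial_sum_add fourier_partial_sum_cmult)
  also have "\<dots> = (\<Sum>k=1..n. a ^ (n - k) / of_nat k * circle_exp 1 x ^ (n - k))"
    by (rule sum.cong) (auto simp: fourier_partial_sum_circle_exp simp flip: circle_exp_of_nat)
  finally show ?thesis
    by (simp add: fejer_half_def power_mult_distrib mult.commute)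
qed

section \<open>Small functions whose partial sums take prescribed values\<close>

text \<open>
  Place at each \<open>x \<in> F\<close> a Fejer polynomial with coefficient \<open>c x / H\<^sub>n\<close>. The coefficients tend
  to \<open>0\<close>, hence so do the norm of the combination and, at \<open>t \<in> F\<close>, the contributions of the
  points \<open>x \<noteq> t\<close> to its partial sum; the contribution of \<open>t\<close> is \<open>c t\<close>. All large \<open>n\<close> work,
  which is what permits combining this with other conditions on \<open>n\<close>.
\<close>

lemma fejer_interpolation:
  fixes F :: "circle set" and c :: "circle \<Rightarrow> complex"
  assumes "finite F" "e > 0"
  shows "\<forall>\<^sub>F n in sequentially. \<exists>g :: circle \<Rightarrow>\<^sub>C complex.
           norm g < e \<and> (\<forall>t\<in>F. dist (fourier_partial_sum n (apply_bcontfun g) t) (c t) < e)"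
proof -
  define a where "a n x = c x / of_real (harm n)" for n x
  define G where "G n t = (\<Sum>x\<in>F. a n x * fejer_poly n (circle_exp 1 t * cnj (circle_exp 1 x)))" for n t
  have a_0: "(\<lambda>n. norm (a n x)) \<longlonglongrightarrow> 0" for x
    unfolding a_def norm_divide norm_of_real
    by (intro tendsto_divide_0[OF tendsto_const] filterlim_at_top_imp_at_infinity
        filterlim_compose[OF filterlim_abs_real harm_at_top])
  have cont: "continuous_on UNIV (G n)" for n
    unfolding G_def by (intro continuous_intros continuous_on_fejer_poly)
  have bound: "norm (G n t) \<le> (\<Sum>x\<in>F. norm (a n x) * 6)" for n t
    unfolding G_def
    by (rule sum_norm_le) (auto simp: norm_mult intro!: mult_left_mono norm_fejer_poly_le)
  have partial: "fourier_partial_sum n (G n) t = (\<Sum>x\<in>F. a n x * fejer_half n (circle_exp 1 t * cnj (circle_exp 1 x)))" for n t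
    unfolding G_def
    by (simp add: fourier_partial_sum_sum \<open>finite F\<close> continuous_on_mult_left continuous_on_fejer_poly
         continuous_on_mult_right continuous_on_circle_exp fourier_partial_sum_cmult fourier_partial_sum_fejer_poly)
  have "(\<lambda>n. \<Sum>x\<in>F. norm (a n x) * 6) \<longlonglongrightarrow> (\<Sum>x\<in>F. 0 * 6)"
    by (intro tendsto_intros a_0)
  then have small: "\<forall>\<^sub>F n in sequentially. (\<Sum>x\<in>F. norm (a n x) * 6) < e"
    using \<open>e > 0\<close> by (intro order_tendstoD) auto
  have "(\<lambda>n. fourier_partial_sum n (G n) t) \<longlonglongrightarrow> (\<Sum>x\<in>F. if x = t then c x else 0)" if "t \<in> F" for t
    unfolding partial
  proof (rule tendsto_sum)
    fix x
    show "(\<lambda>n. a n x * fejer_half n (circle_exp 1 t * cnj (circle_exp 1 x))) \<longlonglongrightarrow> (if x = t then c x else 0)"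
    proof (cases "x = t")
      case True
      have "circle_exp 1 t * cnj (circle_exp 1 t) = 1"
        by (simp flip: circle_exp_uminus circle_exp_add)
      moreover have "\<forall>\<^sub>F n in sequentially. c t = a n t * of_real (harm n)"
        using eventually_gt_at_top[of 0] by eventually_elim (auto simp: a_def dest: harm_pos[where ?'a = real])
      ultimately show ?thesis
        using True by (simp add: fejer_half_1 tendsto_eventually eventually_mono)
    next
      case False
      define u where "u = circle_exp 1 t * cnj (circle_exp 1 x)"
      have "u \<noteq> 1"
      proof
        assume "u = 1"
        then have "circle_exp 1 t * (cnj (circle_exp 1 x) * circle_exp 1 x) = circle_exp 1 x"
          by (simp add: u_def flip: mult.assoc)
        moreover have "cnj (circle_exp 1 x) * circle_exp 1 x = 1"
          by (simp flip: circle_exp_uminus circle_exp_add)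
        ultimately have "circle_exp 1 t = circle_exp 1 x" by simp
        then show False using False inj_circle_exp_1 by (auto dest: injD)
      qed
      have "norm u = 1" by (simp add: u_def norm_mult)
      have "(\<lambda>n. norm (a n x) * (2 / norm (1 - u))) \<longlonglongrightarrow> 0"
        by (rule tendsto_mult_left_zero[OF a_0])
      then have "(\<lambda>n. a n x * fejer_half n u) \<longlonglongrightarrow> 0"
        by (rule Lim_null_comparison[OF always_eventually[OF allI], rotated])
           (simp only: norm_mult, intro mult_left_mono norm_fejer_half_le \<open>norm u = 1\<close> \<open>u \<noteq> 1\<close> norm_ge_zero)
      then show ?thesis using False by (simp add: u_def)
    qed
  qed
  then have "(\<lambda>n. fourier_partial_sum n (G n) t) \<longlonglongrightarrow> c t" if "t \<in> F" for t
    using that \<open>finite F\<close> by (simp add: sum.delta)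
  then have "\<forall>\<^sub>F n in sequentially. \<forall>t\<in>F. dist (fourier_partial_sum n (G n) t) (c t) < e"
    using \<open>finite F\<close> \<open>e > 0\<close> by (intro eventually_ball_finite) (auto simp: tendsto_iff)
  with small show ?thesis
  proof eventually_elim
    case (elim n)
    have "G n \<in> bcontfun" using cont by (simp add: bcontfun_circle)
    then obtain g where g: "apply_bcontfun g = G n" by (metis bcontfunE)
    have "norm g \<le> (\<Sum>x\<in>F. norm (a n x) * 6)"
      by (rule norm_bound) (simp add: g bound)
    then show ?case using elim g by (intro exI[of _ g]) auto
  qed
qed

section \<open>Density of trigonometric polynomials\<close>

inductive trig_poly :: "(circle \<Rightarrow> complex) \<Rightarrow> bool" where
  circle_exp: "trig_poly (circle_exp k)"
| add: "trig_poly p \<Longrightarrow> trig_poly q \<Longrightarrow> trig_poly (\<lambda>t. p t + q t)"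
| cmult: "trig_poly p \<Longrightarrow> trig_poly (\<lambda>t. c * p t)"

lemma trig_poly_continuous: "trig_poly p \<Longrightarrow> continuous_on UNIV p"
  by (induction rule: trig_poly.induct)
     (simp_all add: continuous_on_circle_exp continuous_on_add continuous_on_mult_left)

lemma trig_poly_mult:
  assumes "trig_poly p" "trig_poly q"
  shows "trig_poly (\<lambda>t. p t * q t)"
  using assms(1)
proof induction
  case (circle_exp j)
  show ?case using assms(2)
  proof induction
    case (circle_exp k)
    then show ?case
      using trig_poly.circle_exp[of "j + k"] by (simp add: circle_exp_add[abs_def])
  next
    case (add p q)
    then show ?case using trig_poly.add by (simp add: ring_distribs)
  next
    case (cmult p c)
    then show ?case using trig_poly.cmult[of _ c] by (simp add: mult.left_commute)
  qed
next
  case (add p q)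
  then show ?case using trig_poly.add by (simp add: ring_distribs)
next
  case (cmult p c)
  then show ?case using trig_poly.cmult[of _ c] by (simp add: mult.assoc)
qed

lemma trig_poly_const: "trig_poly (\<lambda>_. c)"
  using trig_poly.cmult[OF trig_poly.circle_exp[of 0], of c] by simp

text \<open>
  A real-linear form on the complex plane is a complex combination of \<open>z\<close> and its conjugate,
  and on the unit circle these are the characters with frequencies \<open>1\<close> and \<open>-1\<close>.
\<close>

lemma trig_poly_of_real_polynomial:
  assumes "real_polynomial_function p"
  shows "trig_poly (\<lambda>t. of_real (p (circle_exp 1 t)))"
  using assms
proof induction
  case (linear f)
  then interpret f: bounded_linear f .
  define a where "a = (of_real (f 1) - \<i> * of_real (f \<i>)) / 2"
  define b where "b = (of_real (f 1) + \<i> * of_real (f \<i>)) / 2"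
  have "of_real (f z) = a * z + b * cnj z" for z
  proof -
    have "f z = f (Re z *\<^sub>R 1 + Im z *\<^sub>R \<i>)"
      by (rule arg_cong[of _ _ f]) (simp add: complex_eq_iff)
    then have "f z = Re z * f 1 + Im z * f \<i>"
      by (simp add: f.add f.scaleR)
    then show ?thesis
      by (simp add: a_def b_def complex_eq_iff field_simps)
  qed
  then have "(\<lambda>t. complex_of_real (f (circle_exp 1 t))) = (\<lambda>t. a * circle_exp 1 t + b * circle_exp (- 1) t)"
    by (simp add: circle_exp_uminus)
  moreover have "trig_poly (\<lambda>t. a * circle_exp 1 t + b * circle_exp (- 1) t)"
    by (rule trig_poly.add[OF trig_poly.cmult[OF trig_poly.circle_exp] trig_poly.cmult[OF trig_poly.circle_exp]])
  ultimately show ?case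
    by simp
next
  case (const c)
  show ?case by (rule trig_poly_const)
next
  case (add f g)
  then show ?case
    using trig_poly.add by simp
next
  case (mult f g)
  then show ?case
    using trig_poly_mult by simp
qed

text \<open>
  By compactness the first character is a homeomorphism onto its image in the plane, so the
  Stone-Weierstrass theorem for polynomial functions on compact subsets of a Euclidean space
  applies to the transported function.
\<close>

theorem trig_poly_dense:
  fixes f :: "circle \<Rightarrow> complex"
  assumes "continuous_on UNIV f" "e > 0"
  obtains p where "trig_poly p" "\<And>t. norm (f t - p t) < e"
proof -
  define g where "g = inv (circle_exp 1)"
  have g: "g (circle_exp 1 t) = t" for t
    by (simp add: g_def inj_circle_exp_1)
  have "continuous_on (range (circle_exp 1)) g"
    by (rule continuous_on_inv) (auto simp: g compact_UNIV_circle continuous_on_circle_exp)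
  then have "continuous_on (range (circle_exp 1)) (f \<circ> g)"
    by (intro continuous_on_compose continuous_on_subset[OF assms(1)]) auto
  moreover have "compact (range (circle_exp 1))"
    by (intro compact_continuous_image continuous_on_circle_exp compact_UNIV_circle)
  ultimately obtain q where q: "polynomial_function q" 
    and close: "\<And>z. z \<in> range (circle_exp 1) \<Longrightarrow> norm ((f \<circ> g) z - q z) < e"
    using Stone_Weierstrass_polynomial_function[of "range (circle_exp 1)" "f \<circ> g" e] \<open>e > 0\<close> by blast
  have "real_polynomial_function (Re \<circ> q)" "real_polynomial_function (Im \<circ> q)"
    using q bounded_linear_Re bounded_linear_Im unfolding polynomial_function_def by blast+
  then have "trig_poly (\<lambda>t. of_real ((Re \<circ> q) (circle_exp 1 t)) + \<i> * of_real ((Im \<circ> q) (circle_exp 1 t)))"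
    by (intro trig_poly.add trig_poly.cmult trig_poly_of_real_polynomial)
  then have "trig_poly (\<lambda>t. q (circle_exp 1 t))"
    by (simp flip: complex_eq)
  then show thesis
    using close[OF rangeI] by (intro that) (simp_all add: g)
qed

lemma fourier_partial_sum_trig_poly:
  assumes "trig_poly p"
  shows "\<forall>\<^sub>F n in sequentially. \<forall>t. fourier_partial_sum n p t = p t"
  using assms
proof induction
  case (circle_exp k)
  show ?case
    using eventually_ge_at_top[of "nat \<bar>k\<bar>"]
    by eventually_elim (auto simp: fourier_partial_sum_circle_exp)
next
  case (add p q)
  from add.IH show ?case
    by eventually_elim (simp add: fourier_partial_sum_add trig_poly_continuous add.hyps)
next
  case (cmult p c)
  from cmult.IH show ?case
    by eventually_elim (simp add: fourier_partial_sum_cmult)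
qed

section \<open>The open dense sets\<close>

definition steerable :: "circle set \<Rightarrow> (circle \<Rightarrow> complex) \<Rightarrow> real \<Rightarrow> nat \<Rightarrow> (circle \<Rightarrow>\<^sub>C complex) set" where
  "steerable F c e N = {f. \<exists>n\<ge>N. \<forall>t\<in>F. dist (fourier_partial_sum n (apply_bcontfun f) t) (c t) < e}"

lemma open_steerable:
  assumes "finite F"
  shows "open (steerable F c e N)"
proof -
  have "steerable F c e N = (\<Union>n\<in>{N..}. \<Inter>t\<in>F. {f. dist (fourier_partial_sum n (apply_bcontfun f) t) (c t) < e})"
    by (auto simp: steerable_def)
  moreover have "open {f :: circle \<Rightarrow>\<^sub>C complex. dist (fourier_partial_sum n (apply_bcontfun f) t) (c t) < e}" for n t
    by (intro open_Collect_less continuous_intros continuous_on_fourier_partial_sum)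
  ultimately show ?thesis
    using assms by (simp add: open_INT open_UN)
qed

text \<open>
  Approximate \<open>f\<close> by a trigonometric polynomial \<open>p\<close>, and correct \<open>p\<close> by a small function whose
  partial sum nearly equals \<open>c - p\<close> on \<open>F\<close>, at an index so large that \<open>p\<close> is its own partial sum.
\<close>

lemma closure_steerable:
  assumes "finite F" "e > 0"
  shows "closure (steerable F c e N) = UNIV"
proof -
  have "\<exists>y\<in>steerable F c e N. dist y f < d" if "d > 0" for f d
  proof -
    obtain p where p: "trig_poly p" and fp: "\<And>t. norm (f t - p t) < d / 4"
      using trig_poly_dense[of f "d / 4"] \<open>d > 0\<close> by auto
    have "p \<in> bcontfun" using trig_poly_continuous[OF p] by (simp add: bcontfun_circle)
    then obtain P where P: "apply_bcontfun P = p" by (metis bcontfunE)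
    have "\<forall>\<^sub>F n in sequentially. \<exists>g :: circle \<Rightarrow>\<^sub>C complex. norm g < min e (d / 2) \<and>
        (\<forall>t\<in>F. dist (fourier_partial_sum n (apply_bcontfun g) t) (c t - p t) < min e (d / 2))"
      by (rule fejer_interpolation) (use assms \<open>d > 0\<close> in auto)
    with fourier_partial_sum_trig_poly[OF p] eventually_ge_at_top[of N]
    have "\<forall>\<^sub>F n in sequentially. n \<ge> N \<and> (\<forall>t. fourier_partial_sum n p t = p t) \<and>
        (\<exists>g :: circle \<Rightarrow>\<^sub>C complex. norm g < min e (d / 2) \<and>
        (\<forall>t\<in>F. dist (fourier_partial_sum n (apply_bcontfun g) t) (c t - p t) < min e (d / 2)))"
      by eventually_elim blast
    then obtain n g where n: "n \<ge> N" "\<And>t. fourier_partial_sum n p t = p t" and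
       g: "norm (g :: circle \<Rightarrow>\<^sub>C complex) < min e (d / 2)" "\<And>t. t \<in> F \<Longrightarrow> dist (fourier_partial_sum n (apply_bcontfun g) t) (c t - p t) < min e (d / 2)"
      by (auto dest!: eventually_happens)
    have "fourier_partial_sum n (P + g) t = p t + fourier_partial_sum n (apply_bcontfun g) t" for t
      using fourier_partial_sum_add[of P g n t] n(2) trig_poly_continuous[OF p] by (simp add: P)
    then have "P + g \<in> steerable F c e N"
      using n(1) g(2) unfolding steerable_def
      by (auto simp: dist_norm algebra_simps intro!: exI[of _ n])
    moreover have "norm (P - f) \<le> d / 4"
      by (rule norm_bound) (use fp in \<open>auto simp: P norm_minus_commute intro: less_imp_le\<close>)
    then have "dist (P + g) f < d"
      using g(1) norm_triangle_ineq[of "P - f" g] \<open>d > 0\<close> by (simp add: dist_norm algebra_simps)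
    ultimately show ?thesis by blast
  qed
  then show ?thesis by (auto simp: closure_approachable)
qed

section \<open>From finite sets to the countable set\<close>

text \<open>
  Diagonalisation: the \<open>j\<close>-th index is chosen for the points of \<open>E\<close> numbered up to \<open>j\<close> and for the
  tolerance \<open>1 / (j + 1)\<close>, so that each point is taken into account from some index on.
\<close>

lemma subsequence_of_approximations:
  fixes s :: "nat \<Rightarrow> 'a \<Rightarrow> 'b::metric_space"
  assumes "countable E"
    and approx: "\<And>F e N. finite F \<Longrightarrow> F \<subseteq> E \<Longrightarrow> e > 0 \<Longrightarrow> \<exists>n\<ge>N. \<forall>t\<in>F. dist (s n t) (h t) < e"
  shows "\<exists>r :: nat \<Rightarrow> nat. strict_mono r \<and> (\<forall>t\<in>E. (\<lambda>j. s (r j) t) \<longlonglongrightarrow> h t)"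
proof -
  obtain idx :: "'a \<Rightarrow> nat" where idx: "inj_on idx E"
    using \<open>countable E\<close> unfolding countable_def by blast
  define F where "F j = {t\<in>E. idx t \<le> j}" for j
  have "finite (F j)" for j
    by (rule finite_imageD[of idx]) (auto simp: F_def intro: finite_subset[of _ "{..j}"] inj_on_subset[OF idx])
  then have step: "\<exists>n\<ge>N. \<forall>t\<in>F j. dist (s n t) (h t) < inverse (Suc j)" for j N
    by (intro approx) (auto simp: F_def)
  have "\<exists>r. \<forall>j. (\<forall>t\<in>F j. dist (s (r j) t) (h t) < inverse (Suc j)) \<and> r j < r (Suc j)"
  proof (rule dependent_nat_choice)
    show "\<exists>n. \<forall>t\<in>F 0. dist (s n t) (h t) < inverse (Suc 0)"
      using step[where j = 0] by blast
    show "\<exists>m. (\<forall>t\<in>F (Suc j). dist (s m t) (h t) < inverse (Suc (Suc j))) \<and> n < m" for n j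
      using step[of "Suc n" "Suc j"] by (metis Suc_le_lessD)
  qed
  then obtain r where r: "\<And>j t. t \<in> F j \<Longrightarrow> dist (s (r j) t) (h t) < inverse (Suc j)" "\<And>j. r j < r (Suc j)"
    by blast
  have "(\<lambda>j. s (r j) t) \<longlonglongrightarrow> h t" if "t \<in> E" for t
  proof (rule metric_tendsto_imp_tendsto[OF LIMSEQ_inverse_real_of_nat])
    show "\<forall>\<^sub>F j in sequentially. dist (s (r j) t) (h t) \<le> dist (inverse (real (Suc j))) 0"
      using eventually_ge_at_top[of "idx t"]
      by eventually_elim (use r(1) that in \<open>force simp: F_def intro: less_imp_le\<close>)
  qed
  moreover have "strict_mono r" using r(2) by (simp add: strict_mono_Suc_iff)
  ultimately show ?thesis by blast
qed

theorem theorem1: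
  fixes E :: "circle set"
  assumes "countable E"
  shows "quasi_all (\<lambda>f :: circle \<Rightarrow>\<^sub>C complex.
           \<forall>h :: circle \<Rightarrow> complex. \<exists>r :: nat \<Rightarrow> nat. strict_mono r \<and>
             (\<forall>t\<in>E. (\<lambda>j. fourier_partial_sum (r j) (apply_bcontfun f) t) \<longlonglongrightarrow> h t))"
proof -
  obtain D :: "complex set" where D: "countable D" "\<And>X. open X \<Longrightarrow> X \<noteq> {} \<Longrightarrow> \<exists>d\<in>D. d \<in> X"
    using countable_dense_setE by metis
  \<comment> \<open>Functions that are undefined outside \<open>F\<close> represent the maps \<open>F \<rightarrow> D\<close>, so that there are only
    countably many of them.\<close>
  define targets where "targets = (SIGMA F : {F. finite F \<and> F \<subseteq> E}. Pi\<^sub>E F (\<lambda>_. D))"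
  define \<G> where "\<G> = (\<lambda>((F, c), k, N). steerable F c (inverse (Suc k)) N) ` (targets \<times> UNIV)"
  have "countable targets"
    unfolding targets_def using assms D(1)
    by (intro countable_SIGMA countable_Collect_finite_subset countable_PiE) auto
  then have "countable \<G>"
    unfolding \<G>_def by (intro countable_image countable_SIGMA) auto
  have \<G>: "open S \<and> closure S = UNIV" if "S \<in> \<G>" for S
    using that by (auto simp: \<G>_def targets_def open_steerable closure_steerable simp del: of_nat_Suc)
  have "gdelta_in euclidean (\<Inter>\<G>)"
  proof (rule gdelta_in_Inter)
    show "\<G> \<noteq> {}" by (force simp: \<G>_def targets_def)
  qed (use \<open>countable \<G>\<close> \<G> in \<open>auto intro: open_imp_gdelta_in\<close>)
  moreover have "closure (\<Inter>\<G>) = UNIV"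
    using Met_TC.metric_Baire_category[of \<G>] \<open>countable \<G>\<close> \<G> complete_bcontfun_circle by simp
  moreover have "\<exists>r :: nat \<Rightarrow> nat. strict_mono r \<and> (\<forall>t\<in>E. (\<lambda>j. fourier_partial_sum (r j) (apply_bcontfun f) t) \<longlonglongrightarrow> h t)"
    if f: "f \<in> \<Inter>\<G>" for f h
  proof (rule subsequence_of_approximations[OF assms])
    fix F :: "circle set" and e :: real and N :: nat
    assume F: "finite F" "F \<subseteq> E" and "e > 0"
    then obtain k where k: "inverse (Suc k) < e / 2"
      using reals_Archimedean[of "e / 2"] by auto
    have "\<exists>d\<in>D. d \<in> ball (h t) (e / 2)" for t
      using \<open>e > 0\<close> by (intro D(2)) auto
    then obtain c where c: "\<And>t. c t \<in> D" "\<And>t. dist (h t) (c t) < e / 2"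
      unfolding mem_ball by metis
    have "(F, restrict c F) \<in> targets"
      using F c(1) by (auto simp: targets_def)
    then have "steerable F (restrict c F) (inverse (Suc k)) N \<in> \<G>"
      unfolding \<G>_def by force
    then have "f \<in> steerable F (restrict c F) (inverse (Suc k)) N"
      using f by blast
    then obtain n where n: "n \<ge> N" "\<And>t. t \<in> F \<Longrightarrow> dist (fourier_partial_sum n (apply_bcontfun f) t) (c t) < inverse (Suc k)"
      by (auto simp: steerable_def)
    have "dist (fourier_partial_sum n (apply_bcontfun f) t) (h t) < e" if "t \<in> F" for t
      using dist_triangle2[of "fourier_partial_sum n (apply_bcontfun f) t" "h t" "c t"] n(2)[OF that] c(2)[of t] k by linarith
    then show "\<exists>n\<ge>N. \<forall>t\<in>F. dist (fourier_partial_sum n (apply_bcontfun f) t) (h t) < e"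
      using n(1) by blast
  qed
  ultimately show ?thesis
    unfolding quasi_all_def residual_def by blast
qed

end
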